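(* Let $X_1,X_2$ be real random variables whose risk measures (as defined in the context) are finite, let $g(u)=F_{X_1}^{-1}(u)+F_{X_2}^{-1}(1-u)$, and let $S^l=g(U)$ with $U$ uniformly distributed on the unit interval, where $S^l$ is not degenerate. For any $x\in(x^{\min},x^{\max})$, let $u_1<\dots<u_N$ be the $N$ ordered elements of the set $E_x$. Then $$\pi_{S^l}(x)=\begin{cases}s_1(x), & \text{if } g(u)\le x \text{ for } u\in(0,u_1),\\ s_2(x), & \text{if } g(u)\ge x\text{ for } u\in(0,u_1),\end{cases}$$ where $$s_1(x)=\pi_{X_1}\!\left(F_{X_1}^{-1(\alpha_1)}(u_1)\right)-\lambda_{X_2}\!\left(F_{X_2}^{-1(1-\alpha_1)}(1-u_1)\right)-\mathcal{S},$$ $$s_2(x)=\pi_{X_2}\!\left(F_{X_2}^{-1(1-\alpha_1)}(1-u_1)\right)-\lambda_{X_1}\!\left(F_{X_1}^{-1(\alpha_1)}(u_1)\right)+\mathcal{S},$$ $$\mathcal{S}=\sum_{j=2}^{N}(-1)^j\left(\pi_{X_1}\!\left(F_{X_1}^{-1(\alpha_j)}(u_j)\right)-\lambda_{X_2}\!\left(F_{X_2}^{-1(1-\alpha_j)}(1-u_j)\right)\right),$$ with the convention $\sum_{j=2}^{1}=0$, and where, for $j=1,2,\dots,N$, $\alpha_j\in[0,1]$ is determined from $$x=F_{X_1}^{-1(\alpha_j)}(u_j)+F_{X_2}^{-1(1-\alpha_j)}(1-u_j).$$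
   Context: Random variables may be discrete, continuous, or a combination of the two. For a real random variable $X$ with cdf $F_X$: $F_X^{-1}(p)=\inf\{y\in\mathbb{R}: F_X(y)\ge p\}$, $F_X^{-1+}(p)=\sup\{y\in\mathbb{R}: F_X(y)\le p\}$, with $\inf\emptyset=+\infty$, $\sup\emptyset=-\infty$, and for $\alpha\in[0,1]$, $F_X^{-1(\alpha)}(p)=(1-\alpha)F_X^{-1}(p)+\alpha F_X^{-1+}(p)$. The upper tail transform (stop-loss premium) is $\pi_X(x)=\mathbb{E}[(X-x)_+]$ and the lower tail transform is $\lambda_X(x)=\mathbb{E}[(x-X)_+]$, where $(y)_+=\max\{y,0\}$. $x^{\min}=\inf_{u\in[0,1]}g(u)$ and $x^{\max}=\sup_{u\in[0,1]}g(u)$. Set $E_x$ (associated with $g$), for $x\in(x^{\min},x^{\max})$: a point $u^*\in(0,1)$ belongs to $E_x$ if and only if there exist $a,b,c\in[0,1]$ with $a<b\le u^*<c$ such that one of the following holds: (1) $g(u)<x$ for $u\in(a,b)$, $g(u)=x$ for $u\in(b,u^* )$, and $g(u)>x$ for $u\in(u^*,c)$; (2) $g(u)>x$ for $u\in(a,b)$, $g(u)=x$ for $u\in(b,u^* )$, and $g(u)<x$ for $u\in(u^*,c)$. (If $b=u^*$ the middle requirement is vacuous.) $N$ denotes the number of elements of $E_x$; $E_x$ is at most countably infinite, and $N=\infty$ is allowed.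
   Formalization: Added hypothesis: any two open intervals on which g−x has opposite strict signs are separated by at least one and at most finitely many points of E_x; without it the formula can fail, e.g. when the value of g at a jump hides a sign change from E_x. *)

theory Defs
  imports "HOL-Probability.Probability" "HOL-Library.Extended_Nat"
begin

text \<open>
  Quantiles take values in the extended reals, so that the conventions on the infimum and the
  supremum of the empty set hold and no value is lost at the levels 0 and 1. Levels strictly
  between 0 and 1 have finite quantiles.
\<close>

definition quantile :: "'a measure \<Rightarrow> ('a \<Rightarrow> real) \<Rightarrow> real \<Rightarrow> ereal" where
  "quantile M X p = Inf {ereal y |y. cdf (distr M borel X) y \<ge> p}"

definition upper_quantile :: "'a measure \<Rightarrow> ('a \<Rightarrow> real) \<Rightarrow> real \<Rightarrow> ereal" where
  "upper_quantile M X p = Sup {ereal y |y. cdf (distr M borel X) y \<le> p}"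

definition mixed_quantile :: "'a measure \<Rightarrow> ('a \<Rightarrow> real) \<Rightarrow> real \<Rightarrow> real \<Rightarrow> ereal" where
  "mixed_quantile M X \<alpha> p =
     ereal (1 - \<alpha>) * quantile M X p + ereal \<alpha> * upper_quantile M X p"

definition upper_tail :: "'a measure \<Rightarrow> ('a \<Rightarrow> real) \<Rightarrow> real \<Rightarrow> real" where
  "upper_tail M X x = (\<integral>\<omega>. max (X \<omega> - x) 0 \<partial>M)"

definition lower_tail :: "'a measure \<Rightarrow> ('a \<Rightarrow> real) \<Rightarrow> real \<Rightarrow> real" where
  "lower_tail M X x = (\<integral>\<omega>. max (x - X \<omega>) 0 \<partial>M)"

text \<open>
  Finiteness of the tail transforms has to be stated as integrability, since the integral of a
  non-integrable function is 0. The quantiles at levels strictly between 0 and 1 are always finite.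
\<close>

definition finite_risk_measures :: "'a measure \<Rightarrow> ('a \<Rightarrow> real) \<Rightarrow> bool" where
  "finite_risk_measures M X \<longleftrightarrow>
     (\<forall>x. integrable M (\<lambda>\<omega>. max (X \<omega> - x) 0) \<and> integrable M (\<lambda>\<omega>. max (x - X \<omega>) 0))"

text \<open>
  At the levels 0 and 1 the sum below may have the form \<open>\<infinity> + (-\<infinity>)\<close>, which is \<open>\<infinity>\<close> for
  type \<open>ereal\<close>. This only affects the two bounds \<open>x_min\<close> and \<open>x_max\<close>, and the interval
  between them always contains the one obtained from the levels in the open unit interval.
\<close>

definition countermonotonic_g ::
    "'a measure \<Rightarrow> ('a \<Rightarrow> real) \<Rightarrow> ('a \<Rightarrow> real) \<Rightarrow> real \<Rightarrow> ereal" where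
  "countermonotonic_g M X1 X2 u = quantile M X1 u + quantile M X2 (1 - u)"

definition x_min :: "(real \<Rightarrow> ereal) \<Rightarrow> ereal" where
  "x_min g = (INF u\<in>{0..1}. g u)"

definition x_max :: "(real \<Rightarrow> ereal) \<Rightarrow> ereal" where
  "x_max g = (SUP u\<in>{0..1}. g u)"

definition uniform_unit :: "'b measure \<Rightarrow> ('b \<Rightarrow> real) \<Rightarrow> bool" where
  "uniform_unit P U \<longleftrightarrow>
     U \<in> borel_measurable P \<and> distr P borel U = uniform_measure lborel {0..1}"

definition degenerate :: "'b measure \<Rightarrow> ('b \<Rightarrow> real) \<Rightarrow> bool" where
  "degenerate P S \<longleftrightarrow> (\<exists>c. AE \<omega> in P. S \<omega> = c)"

definition crossing_set :: "(real \<Rightarrow> ereal) \<Rightarrow> real \<Rightarrow> real set" where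
  "crossing_set g x =
     {u \<in> {0<..<1}. \<exists>a\<in>{0..1}. \<exists>b\<in>{0..1}. \<exists>c\<in>{0..1}. a < b \<and> b \<le> u \<and> u < c \<and>
        ((\<forall>v\<in>{a<..<b}. g v < ereal x) \<and> (\<forall>v\<in>{b<..<u}. g v = ereal x) \<and>
           (\<forall>v\<in>{u<..<c}. g v > ereal x)
         \<or>
         (\<forall>v\<in>{a<..<b}. g v > ereal x) \<and> (\<forall>v\<in>{b<..<u}. g v = ereal x) \<and>
           (\<forall>v\<in>{u<..<c}. g v < ereal x))}"

definition enumerates :: "real set \<Rightarrow> enat \<Rightarrow> (nat \<Rightarrow> real) \<Rightarrow> bool" where
  "enumerates E N u \<longleftrightarrow>
     strict_mono_on {j. 1 \<le> j \<and> enat j \<le> N} u \<and> u ` {j. 1 \<le> j \<and> enat j \<le> N} = E"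

text \<open>
  Two open intervals on which \<open>g - x\<close> has opposite strict signs are separated by at least one
  and at most finitely many points of \<open>crossing_set g x\<close>.

  For an arbitrary \<open>g\<close>, \<open>crossing_set g x\<close> can miss a change of sign. With \<open>x = 1\<close> and
  \<open>g = 0, 2, 1, 1, 0\<close> on the open intervals with endpoints \<open>0, 1/5, 2/5, 1/2, 3/5, 1\<close>, and
  \<open>g (1/2) = 0\<close> because the quantile functions of both summands jump there, the only element
  is \<open>1/5\<close>: the exceptional value at \<open>1/2\<close> hides the change from above to below \<open>x\<close>.
  For continuous \<open>g\<close> the same happens if the points at which \<open>g\<close> touches the level \<open>x\<close>
  accumulate at a change of sign. If infinitely many elements accumulate at a point of \<open>(0, 1)\<close>
  beyond which \<open>g\<close> is not almost everywhere equal to \<open>x\<close>, the alternating series over the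
  elements may diverge. Infinitely many elements that accumulate only at 1 are allowed.
\<close>

definition regular_crossings :: "(real \<Rightarrow> ereal) \<Rightarrow> real \<Rightarrow> bool" where
  "regular_crossings g x \<longleftrightarrow>
     (\<forall>a b c d. 0 \<le> a \<and> a < b \<and> b \<le> c \<and> c < d \<and> d \<le> 1 \<and>
        ((\<forall>v\<in>{a<..<b}. g v < ereal x) \<and> (\<forall>v\<in>{c<..<d}. g v > ereal x) \<or>
         (\<forall>v\<in>{a<..<b}. g v > ereal x) \<and> (\<forall>v\<in>{c<..<d}. g v < ereal x))
        \<longrightarrow> crossing_set g x \<inter> {b..c} \<noteq> {} \<and> finite (crossing_set g x \<inter> {b..c}))"

text \<open>
  The quantiles in the following definitions are used at levels in the open unit interval only,
  where they are finite and the conversion to \<open>real\<close> is exact.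
\<close>

definition upper_tail_at :: "'a measure \<Rightarrow> ('a \<Rightarrow> real) \<Rightarrow> real \<Rightarrow> real \<Rightarrow> real" where
  "upper_tail_at M X \<alpha> p = upper_tail M X (real_of_ereal (mixed_quantile M X \<alpha> p))"

definition lower_tail_at :: "'a measure \<Rightarrow> ('a \<Rightarrow> real) \<Rightarrow> real \<Rightarrow> real \<Rightarrow> real" where
  "lower_tail_at M X \<alpha> p = lower_tail M X (real_of_ereal (mixed_quantile M X \<alpha> p))"

definition S_term :: "'a measure \<Rightarrow> ('a \<Rightarrow> real) \<Rightarrow> ('a \<Rightarrow> real) \<Rightarrow> enat \<Rightarrow>
    (nat \<Rightarrow> real) \<Rightarrow> (nat \<Rightarrow> real) \<Rightarrow> nat \<Rightarrow> real" where
  "S_term M X1 X2 N u \<alpha> j =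
     (if 2 \<le> j \<and> enat j \<le> N
      then (-1) ^ j * (upper_tail_at M X1 (\<alpha> j) (u j)
                       - lower_tail_at M X2 (1 - \<alpha> j) (1 - u j))
      else 0)"

definition s1 :: "'a measure \<Rightarrow> ('a \<Rightarrow> real) \<Rightarrow> ('a \<Rightarrow> real) \<Rightarrow> enat \<Rightarrow>
    (nat \<Rightarrow> real) \<Rightarrow> (nat \<Rightarrow> real) \<Rightarrow> real" where
  "s1 M X1 X2 N u \<alpha> =
     upper_tail_at M X1 (\<alpha> 1) (u 1) - lower_tail_at M X2 (1 - \<alpha> 1) (1 - u 1)
     - (\<Sum>j. S_term M X1 X2 N u \<alpha> j)"

definition s2 :: "'a measure \<Rightarrow> ('a \<Rightarrow> real) \<Rightarrow> ('a \<Rightarrow> real) \<Rightarrow> enat \<Rightarrow>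
    (nat \<Rightarrow> real) \<Rightarrow> (nat \<Rightarrow> real) \<Rightarrow> real" where
  "s2 M X1 X2 N u \<alpha> =
     upper_tail_at M X2 (1 - \<alpha> 1) (1 - u 1) - lower_tail_at M X1 (\<alpha> 1) (u 1)
     + (\<Sum>j. S_term M X1 X2 N u \<alpha> j)"

end

theory Submission
  imports Defs
begin

text \<open>
  Put \<open>h = g - x\<close> on the open unit interval. If \<open>x = d1 + d2\<close> with \<open>d1\<close> between the lower and upper
  quantile of \<open>X1\<close> at \<open>u\<close> and \<open>d2\<close> between those of \<open>X2\<close> at \<open>1 - u\<close>, then by the quantile transform
  \<open>\<pi>\<^sub>1(d1) - \<lambda>\<^sub>2(d2)\<close> is the integral of \<open>h\<close> over \<open>(u, 1)\<close>, and \<open>\<pi>\<^sub>2(d2) - \<lambda>\<^sub>1(d1)\<close> is the integral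
  over \<open>(0, u)\<close>. The function \<open>h\<close> has weakly constant, alternating signs between consecutive crossings,
  except at countably many jumps, and it vanishes off the jumps beyond the limit of infinitely many
  crossings. Hence the alternating sum of the tail integrals of \<open>h\<close> telescopes to the integral of
  the positive part of \<open>h\<close> if \<open>h \<le> 0\<close> near 0. The case \<open>h \<ge> 0\<close> near 0 follows by passing to \<open>-h\<close>.
\<close>

section \<open>Quantile functions\<close>

locale real_random_variable = prob_space M for M :: "'a measure" +
  fixes X :: "'a \<Rightarrow> real"
  assumes rv [measurable]: "X \<in> borel_measurable M"
begin

sublocale D: cdf_distribution "distr M borel X"
  unfolding cdf_distribution_def by (rule real_distribution_distr) simp

text \<open>The real-valued shape of the generalised inverse of a cdf, so that facts such as
  \<open>D.pseudoinverse\<close> and \<open>D.distr_I_eq_M\<close> apply. By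
  \<open>quantile_eq\<close> no value is lost at levels in the open unit interval.\<close>

definition Q :: "real \<Rightarrow> real" where
  "Q v = Inf {y. v \<le> D.C y}"

definition Qu :: "real \<Rightarrow> real" where
  "Qu v = Sup {y. D.C y \<le> v}"

lemma Q_le_iff:
  assumes "v \<in> {0<..<1}"
  shows "Q v \<le> y \<longleftrightarrow> v \<le> D.C y"
  using D.pseudoinverse[of v y] assms by (simp add: Q_def)

lemma less_Q_iff:
  assumes "v \<in> {0<..<1}"
  shows "y < Q v \<longleftrightarrow> D.C y < v"
  using Q_le_iff[OF assms, of y] by linarith

lemma Q_mono: "mono_on {0<..<1} Q"
  using D.mono_I by (simp add: Q_def[abs_def])

lemma quantile_eq:
  assumes "v \<in> {0<..<1}"
  shows "quantile M X v = ereal (Q v)"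
  unfolding quantile_def
proof (rule cInf_eq_minimum)
  show "ereal (Q v) \<in> {ereal y |y. v \<le> D.C y}"
    using Q_le_iff[OF assms] by auto
qed (use Q_le_iff[OF assms] in auto)

lemma level_bdd_above:
  assumes "v < 1"
  shows "bdd_above {y. D.C y \<le> v}"
proof -
  obtain y where "v < D.C y"
    by (metis eventually_happens' trivial_limit_at_top_linorder order_tendstoD(1) D.top assms)
  then have "z \<le> y" if "D.C z \<le> v" for z
    using D.cdf_nondecreasing[of y z] that by linarith
  then show ?thesis by (intro bdd_aboveI[of _ y]) auto
qed

lemma level_nonempty:
  assumes "0 < v"
  shows "{y. D.C y \<le> v} \<noteq> {}"
proof -
  obtain y where "D.C y < v"
    by (metis eventually_happens' trivial_limit_at_bot_linorder order_tendstoD(2) D.bot assms)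
  then show ?thesis by (auto intro: less_imp_le)
qed

lemma le_Qu:
  assumes "v < 1" and "D.C y \<le> v"
  shows "y \<le> Qu v"
  unfolding Qu_def using assms level_bdd_above by (auto intro!: cSup_upper)

lemma cdf_le_of_less_Qu:
  assumes "v \<in> {0<..<1}" and "y < Qu v"
  shows "D.C y \<le> v"
proof -
  obtain z where "D.C z \<le> v" "y < z"
    using less_cSupE[of y "{y. D.C y \<le> v}"] level_nonempty assms by (auto simp: Qu_def)
  then show ?thesis using D.cdf_nondecreasing[of y z] by linarith
qed

lemma upper_quantile_eq:
  assumes v: "v \<in> {0<..<1}"
  shows "upper_quantile M X v = ereal (Qu v)"
  unfolding upper_quantile_def
proof (rule Sup_eqI)
  show "z \<le> ereal (Qu v)" if "z \<in> {ereal y |y. D.C y \<le> v}" for z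
    using that le_Qu v by auto
  show "ereal (Qu v) \<le> z" if *: "\<And>y. y \<in> {ereal y |y. D.C y \<le> v} \<Longrightarrow> y \<le> z" for z
  proof -
    obtain y where y: "D.C y \<le> v"
      using level_nonempty v by auto
    have "y' \<le> real_of_ereal z" if "z \<noteq> \<infinity>" "D.C y' \<le> v" for y'
      using *[of "ereal y"] *[of "ereal y'"] y that by (cases z) auto
    then have "Qu v \<le> real_of_ereal z" if "z \<noteq> \<infinity>"
      unfolding Qu_def using level_nonempty v that by (intro cSup_least) auto
    then show ?thesis
      using *[of "ereal y"] y by (cases z) auto
  qed
qed

lemma Q_le_Qu:
  assumes "v \<in> {0<..<1}"
  shows "Q v \<le> Qu v"
proof (rule dense_le)
  fix y assume "y < Q v"
  then show "y \<le> Qu v"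
    using less_Q_iff[OF assms, of y] assms by (intro le_Qu) auto
qed

text \<open>Below \<open>Qu v\<close> the cdf is at most \<open>v\<close>, hence strictly less than
  \<open>w\<close>, and a cdf value strictly below \<open>w\<close> means lying left of
  \<open>Q w\<close>. This makes \<open>Qu v\<close> the right limit of \<open>Q\<close> at
  \<open>v\<close> and locates where \<open>Q\<close> passes a value between \<open>Q v\<close> and
  \<open>Qu v\<close>.\<close>

lemma Qu_le_Q:
  assumes "v \<in> {0<..<1}" and "w \<in> {0<..<1}" and "v < w"
  shows "Qu v \<le> Q w"
proof (rule dense_le)
  fix y assume "y < Qu v"
  then have "D.C y < w"
    using cdf_le_of_less_Qu[OF assms(1), of y] \<open>v < w\<close> by linarith
  then show "y \<le> Q w"
    using less_Q_iff[OF assms(2)] by (simp add: less_imp_le)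
qed

lemma tendsto_Q_left:
  assumes v: "v \<in> {0<..<1}"
  shows "(Q \<longlongrightarrow> Q v) (at_left v)"
proof (rule order_tendstoI)
  fix y assume "y < Q v"
  \<comment> \<open>The maximum with 0 keeps the levels near \<open>v\<close> inside the open unit
    interval, where \<open>less_Q_iff\<close> is valid.\<close>
  then have "max 0 (D.C y) < v"
    using less_Q_iff[OF v] v by auto
  then have "\<forall>\<^sub>F w in at_left v. w \<in> {max 0 (D.C y)<..<v}"
    by (rule eventually_at_left_real)
  then show "\<forall>\<^sub>F w in at_left v. y < Q w"
    by eventually_elim (use less_Q_iff v in auto)
next
  fix y assume *: "Q v < y"
  have "\<forall>\<^sub>F w in at_left v. w \<in> {0<..<v}"
    using v by (intro eventually_at_left_real) auto
  then show "\<forall>\<^sub>F w in at_left v. Q w < y"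
  proof eventually_elim
    case (elim w)
    then have "Q w \<le> Q v" using v by (intro mono_onD[OF Q_mono]) auto
    with * show ?case by simp
  qed
qed

lemma tendsto_Q_right:
  assumes v: "v \<in> {0<..<1}"
  shows "(Q \<longlongrightarrow> Qu v) (at_right v)"
proof (rule order_tendstoI)
  fix y assume *: "y < Qu v"
  have "\<forall>\<^sub>F w in at_right v. w \<in> {v<..<1}"
    using v by (intro eventually_at_right_real) auto
  then show "\<forall>\<^sub>F w in at_right v. y < Q w"
  proof eventually_elim
    case (elim w)
    then have "Qu v \<le> Q w" using v by (intro Qu_le_Q) auto
    with * show ?case by simp
  qed
next
  fix y assume "Qu v < y"
  \<comment> \<open>\<open>Q_le_iff\<close> bounds \<open>Q w\<close> only weakly, so a point
    \<open>z\<close> strictly between is inserted to obtain a strict bound by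
    \<open>y\<close>.\<close>
  then obtain z where z: "Qu v < z" "z < y" using dense by blast
  then have "v < min 1 (D.C z)"
    using le_Qu[of v z] v by (auto simp: not_less[symmetric])
  then have "\<forall>\<^sub>F w in at_right v. w \<in> {v<..<min 1 (D.C z)}"
    by (rule eventually_at_right_real)
  then show "\<forall>\<^sub>F w in at_right v. Q w < y"
  proof eventually_elim
    case (elim w)
    then have "Q w \<le> z" using v by (subst Q_le_iff) auto
    with z show ?case by simp
  qed
qed

lemma mixed_quantile_eq:
  assumes "v \<in> {0<..<1}"
  shows "mixed_quantile M X a v = ereal ((1 - a) * Q v + a * Qu v)"
  using assms by (simp add: mixed_quantile_def quantile_eq upper_quantile_eq)

lemma measurable_Q [measurable]: "Q \<in> borel_measurable (restrict_space lborel {0<..<1})"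
  using D.measurable_CI by (simp add: Q_def[abs_def] cong: measurable_cong_sets)

text \<open>Levels outside the unit interval matter only because measurability of \<open>g\<close>
  is needed on the whole real line.\<close>

lemma quantile_neg: "v < 0 \<Longrightarrow> quantile M X v = -\<infinity>"
proof -
  assume v: "v < 0"
  have "quantile M X v \<le> ereal y" for y
    unfolding quantile_def using v D.cdf_nonneg[of y] by (intro Inf_lower) auto
  then show ?thesis by (simp add: ereal_bot)
qed

lemma quantile_gt_1:
  assumes "1 < v" shows "quantile M X v = \<infinity>"
proof -
  have "\<not> v \<le> D.C y" for y using D.cdf_bounded_prob[of y] assms by simp
  then show ?thesis by (simp add: quantile_def top_ereal_def)
qed

text \<open>Quantile transform: under Lebesgue measure on the open unit interval \<open>Q\<close>
  has the law of \<open>X\<close>. The two endpoints form a null set, so the closed interval can be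
  used throughout.\<close>

lemma absolutely_integrable_Q:
  fixes \<phi> :: "real \<Rightarrow> real"
  assumes [measurable]: "\<phi> \<in> borel_measurable borel"
    and int: "integrable M (\<lambda>\<omega>. \<phi> (X \<omega>))"
  shows "(\<lambda>v. \<phi> (Q v)) absolutely_integrable_on {0..1}"
    and "((\<lambda>v. \<phi> (Q v)) has_integral (\<integral>\<omega>. \<phi> (X \<omega>) \<partial>M)) {0..1}"
proof -
  let ?R = "restrict_space lborel {0<..<1::real}"
  have D: "distr ?R borel Q = distr M borel X"
    using D.distr_I_eq_M by (simp add: Q_def[abs_def])
  have "integrable (distr M borel X) \<phi>"
    using int by (subst integrable_distr_eq) auto
  then have "integrable ?R (\<lambda>v. \<phi> (Q v))"
    unfolding D[symmetric] by (subst (asm) integrable_distr_eq) auto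
  then have si: "set_integrable lborel {0<..<1} (\<lambda>v. \<phi> (Q v))"
    by (simp add: integrable_restrict_space set_integrable_def)
  have "(\<integral>\<omega>. \<phi> (X \<omega>) \<partial>M) = (\<integral>y. \<phi> y \<partial>distr M borel X)"
    by (subst integral_distr) auto
  also have "\<dots> = (\<integral>v. \<phi> (Q v) \<partial>?R)"
    unfolding D[symmetric] by (subst integral_distr) auto
  also have "\<dots> = (LINT v:{0<..<1}|lborel. \<phi> (Q v))"
    by (simp add: integral_restrict_space set_lebesgue_integral_def)
  also have "\<dots> = integral {0<..<1} (\<lambda>v. \<phi> (Q v))"
    by (rule set_borel_integral_eq_integral(2)[OF si])
  finally show "((\<lambda>v. \<phi> (Q v)) has_integral (\<integral>\<omega>. \<phi> (X \<omega>) \<partial>M)) {0..1}"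
    unfolding has_integral_Icc_iff_Ioo
    using set_borel_integral_eq_integral(1)[OF si] by (simp add: integrable_integral)
  \<comment> \<open>Absolute integrability refers to the completion of \<open>lborel\<close>, to
    which Borel integrability carries over.\<close>
  show "(\<lambda>v. \<phi> (Q v)) absolutely_integrable_on {0..1}"
    unfolding absolutely_integrable_on_Icc_iff_Ioo
    using si integrable_completion[of "\<lambda>v. indicator {0<..<1} v *\<^sub>R \<phi> (Q v)" lborel]
    unfolding set_integrable_def by (simp add: borel_measurable_integrable)
qed

section \<open>Tail transforms as integrals of the quantile function\<close>

context
  assumes finite_risk: "finite_risk_measures M X"
begin

lemma integrable_tails:
  "integrable M (\<lambda>\<omega>. max (X \<omega> - d) 0)" "integrable M (\<lambda>\<omega>. max (d - X \<omega>) 0)"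
  using finite_risk by (auto simp: finite_risk_measures_def)

lemma integrable_Q: "Q absolutely_integrable_on {0..1}"
proof -
  have "integrable M (\<lambda>\<omega>. max (X \<omega> - 0) 0 - max (0 - X \<omega>) 0)"
    by (intro Bochner_Integration.integrable_diff integrable_tails)
  also have "(\<lambda>\<omega>. max (X \<omega> - 0) 0 - max (0 - X \<omega>) 0) = X" by (auto simp: max_def)
  finally have "integrable M X" .
  then show ?thesis using absolutely_integrable_Q(1)[of "\<lambda>y. y"] by simp
qed

context
  fixes v d :: real
  assumes v: "v \<in> {0<..<1}" and d: "d \<in> {Q v..Qu v}"
begin

text \<open>Since \<open>d\<close> lies between the lower and upper quantile at \<open>v\<close>,
  \<open>Q\<close> is at most \<open>d\<close> up to \<open>v\<close> and at least \<open>d\<close>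
  beyond it. Taking the positive part of \<open>Q - d\<close> is therefore the same as cutting off
  at \<open>v\<close>.\<close>

lemma upper_tail_has_integral: "((\<lambda>w. Q w - d) has_integral upper_tail M X d) {v..1}"
proof -
  have "((\<lambda>w. max (Q w - d) 0) has_integral upper_tail M X d) {0<..<1}"
    using absolutely_integrable_Q(2)[of "\<lambda>y. max (y - d) 0"] integrable_tails(1)
    unfolding has_integral_Icc_iff_Ioo by (simp add: upper_tail_def)
  also have "?this \<longleftrightarrow> ((\<lambda>w. if w \<in> {v<..<1} then Q w - d else 0) has_integral upper_tail M X d) {0<..<1}"
  proof (intro has_integral_cong)
    fix w :: real assume w: "w \<in> {0<..<1}"
    have "Qu v \<le> Q w" if "v < w" using Qu_le_Q that v w by auto
    moreover have "Q w \<le> Q v" if "w \<le> v" using mono_onD[OF Q_mono] that v w by auto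
    ultimately show "max (Q w - d) 0 = (if w \<in> {v<..<1} then Q w - d else 0)"
      using d w by (force simp: max_def)
  qed
  also have "\<dots> \<longleftrightarrow> ((\<lambda>w. Q w - d) has_integral upper_tail M X d) {v<..<1}"
    using v by (intro has_integral_restrict) auto
  finally show ?thesis by (simp add: has_integral_Icc_iff_Ioo)
qed

lemma lower_tail_has_integral: "((\<lambda>w. d - Q w) has_integral lower_tail M X d) {0..v}"
proof -
  have "((\<lambda>w. max (d - Q w) 0) has_integral lower_tail M X d) {0<..<1}"
    using absolutely_integrable_Q(2)[of "\<lambda>y. max (d - y) 0"] integrable_tails(2)
    unfolding has_integral_Icc_iff_Ioo by (simp add: lower_tail_def)
  also have "?this \<longleftrightarrow> ((\<lambda>w. if w \<in> {0<..<v} then d - Q w else 0) has_integral lower_tail M X d) {0<..<1}"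
  \<comment> \<open>At \<open>v\<close> itself only \<open>Q v \<le> d\<close> is known, so the two
    integrands may differ there and the point is removed as a null set.\<close>
  proof (intro has_integral_spike_eq[of "{v}"])
    fix w :: real assume w: "w \<in> {0<..<1} - {v}"
    have "Qu v \<le> Q w" if "v < w" using Qu_le_Q that v w by auto
    moreover have "Q w \<le> Q v" if "w \<le> v" using mono_onD[OF Q_mono] that v w by auto
    ultimately show "(if w \<in> {0<..<v} then d - Q w else 0) = max (d - Q w) 0"
      using d w by (cases "v < w") (auto simp: max_def)
  qed simp
  also have "\<dots> \<longleftrightarrow> ((\<lambda>w. d - Q w) has_integral lower_tail M X d) {0<..<v}"
    using v by (intro has_integral_restrict) auto
  finally show ?thesis by (simp add: has_integral_Icc_iff_Ioo)
qed

end

end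

end

section \<open>Sign changes and alternating tail integrals\<close>

text \<open>Between \<open>w j\<close> and \<open>w (Suc j)\<close> the positive part of
  \<open>h\<close> is almost everywhere 0 for even \<open>j\<close> and \<open>h\<close> for odd
  \<open>j\<close>. Consecutive tail integrals with opposite signs leave exactly the integral over
  the piece between them, so the sum telescopes to the integral of the positive part.\<close>

lemma alternating_tail_integrals_sums:
  fixes h :: "real \<Rightarrow> real" and w :: "nat \<Rightarrow> real"
  assumes hi: "h integrable_on {0..1}" and hp: "(\<lambda>v. max (h v) 0) integrable_on {0..1}"
    and K: "countable K"
    and w0: "w 0 = 0" and w: "incseq w" "\<And>j. w j \<le> 1" and L: "w \<longlonglongrightarrow> L"
    and sgn: "\<And>j v. v \<in> {w j<..<w (Suc j)} - K \<Longrightarrow> (-1) ^ j * h v \<le> 0"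
    and tail: "\<And>v. v \<in> {L<..<1} - K \<Longrightarrow> h v = 0"
  shows "(\<lambda>j. (-1) ^ j * integral {w (Suc j)..1} h) sums integral {0..1} (\<lambda>v. max (h v) 0)"
proof -
  let ?p = "\<lambda>v. max (h v) 0"
  let ?T = "\<lambda>c. integral {c..1} h" and ?G = "\<lambda>c. integral {0..c} ?p"
  have w_mono: "w i \<le> w j" if "i \<le> j" for i j using w(1) that by (rule incseqD)
  have w_ge: "0 \<le> w j" for j using w_mono[of 0 j] w0 by simp
  have L01: "0 \<le> L" "L \<le> 1" "w j \<le> L" for j
    using LIMSEQ_le_const[OF L] LIMSEQ_le_const2[OF L] incseq_le[OF w(1) L] w_ge w(2) by auto
  have spike: "integral {a..b} f = integral {a..b} f'"
    if "\<And>v. v \<in> {a<..<b} - K \<Longrightarrow> f v = f' v" for a b and f f' :: "real \<Rightarrow> real"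
  proof (rule integral_spike[of "K \<union> {a, b}"])
    show "negligible (K \<union> {a, b})" using K
      by (auto simp: negligible_iff_null_sets intro!: null_sets_completionI countable_imp_null_set_lborel)
    show "f' v = f v" if "v \<in> {a..b} - (K \<union> {a, b})" for v
      using that \<open>\<And>v. v \<in> {a<..<b} - K \<Longrightarrow> f v = f' v\<close>[of v] by auto
  qed
  have T_split: "?T a = integral {a..b} h + ?T b" if "0 \<le> a" "a \<le> b" "b \<le> 1" for a b
  proof -
    have "h integrable_on {a..1}"
      using hi integrable_on_subinterval[of h "{0..1}" a 1] that by auto
    then show ?thesis using that by (simp add: Henstock_Kurzweil_Integration.integral_combine)
  qed
  have G_split: "?G b = ?G a + integral {a..b} ?p" if "0 \<le> a" "a \<le> b" "b \<le> 1" for a b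
  proof -
    have "?p integrable_on {0..b}"
      using hp integrable_on_subinterval[of ?p "{0..1}" 0 b] that by auto
    then show ?thesis using that by (simp add: Henstock_Kurzweil_Integration.integral_combine)
  qed
  have piece: "integral {w j..w (Suc j)} ?p = (if odd j then integral {w j..w (Suc j)} h else 0)" for j
  proof (cases "odd j")
    case True
    have "integral {w j..w (Suc j)} ?p = integral {w j..w (Suc j)} h"
      by (rule spike) (use sgn[of _ j] True in \<open>force simp: max_def\<close>)
    with True show ?thesis by simp
  next
    case False
    have "integral {w j..w (Suc j)} ?p = integral {w j..w (Suc j)} (\<lambda>_. 0)"
      by (rule spike) (use sgn[of _ j] False in \<open>auto simp: max_def\<close>)
    with False show ?thesis by simp
  qed
  \<comment> \<open>After an odd number of terms the last tail integral has not been cancelled yet;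
    this remainder must vanish in the limit.\<close>
  have partial: "(\<Sum>j<n. (-1) ^ j * ?T (w (Suc j))) = ?G (w n) + (if odd n then ?T (w n) else 0)" for n
  proof (induction n)
    case 0
    then show ?case by (simp add: w0)
  next
    case (Suc n)
    have "?G (w (Suc n)) = ?G (w n) + integral {w n..w (Suc n)} ?p"
      "?T (w n) = integral {w n..w (Suc n)} h + ?T (w (Suc n))"
      using w_ge w_mono w(2) by (auto intro!: G_split T_split)
    then show ?case using Suc piece[of n] by auto
  qed
  have "continuous_on {0..1} ?G" by (rule indefinite_integral_continuous_1[OF hp])
  then have G_lim: "(\<lambda>n. ?G (w n)) \<longlonglongrightarrow> ?G L"
    using continuous_on_tendsto_compose[OF _ L, of "{0..1}" ?G] L01 w_ge w(2) by auto
  \<comment> \<open>The remainder tends to the tail integral from \<open>L\<close>, which is 0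
    because \<open>h\<close> vanishes beyond \<open>L\<close> off \<open>K\<close>.\<close>
  have "continuous_on {0..1} (\<lambda>c. integral {0..c} h)" by (rule indefinite_integral_continuous_1[OF hi])
  then have "(\<lambda>n. integral {0..w n} h) \<longlonglongrightarrow> integral {0..L} h"
    using continuous_on_tendsto_compose[OF _ L, of "{0..1}"] L01 w_ge w(2) by auto
  then have "(\<lambda>n. ?T 0 - integral {0..w n} h) \<longlonglongrightarrow> ?T 0 - integral {0..L} h"
    by (intro tendsto_intros)
  moreover have "?T 0 - integral {0..c} h = ?T c" if "0 \<le> c" "c \<le> 1" for c
    using T_split[of 0 c] that by simp
  ultimately have "(\<lambda>n. ?T (w n)) \<longlonglongrightarrow> ?T L" using w_ge w(2) L01 by simp
  moreover have "?T L = integral {L..1} (\<lambda>_. 0)" by (rule spike) (use tail in auto)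
  ultimately have "(\<lambda>n. ?T (w n)) \<longlonglongrightarrow> 0" by simp
  from tendsto_norm_zero[OF this] have "(\<lambda>n. if odd n then ?T (w n) else 0) \<longlonglongrightarrow> 0"
    by (rule Lim_null_comparison[rotated]) simp
  from tendsto_add[OF G_lim this]
  have "(\<lambda>n. \<Sum>j<n. (-1) ^ j * ?T (w (Suc j))) \<longlonglongrightarrow> ?G L" by (simp only: partial add_0_right)
  moreover have "integral {L..1} ?p = integral {L..1} (\<lambda>_. 0)" by (rule spike) (use tail in auto)
  then have "?G L = ?G 1" using G_split[of L 1] L01 by simp
  ultimately show ?thesis by (simp add: sums_def)
qed

text \<open>The factor \<open>e\<close>, always 1 or -1 below, treats both directions of a crossing
  at once. Requiring \<open>a < b\<close> keeps the condition from holding vacuously.\<close>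

definition signed_on :: "real \<Rightarrow> (real \<Rightarrow> real) \<Rightarrow> real \<Rightarrow> real \<Rightarrow> bool" where
  "signed_on e h a b \<longleftrightarrow> a < b \<and> (\<forall>v\<in>{a<..<b}. 0 < e * h v)"

lemma signed_on_subinterval:
  "signed_on e h a b \<Longrightarrow> a \<le> a' \<Longrightarrow> a' < b' \<Longrightarrow> b' \<le> b \<Longrightarrow> signed_on e h a' b'"
  by (auto simp: signed_on_def)

text \<open>
  The crossings preceded by 0 and, if there are finitely many, continued by the constant 1; the
  summation index of the paper starts at 1.
\<close>
definition padded :: "enat \<Rightarrow> (nat \<Rightarrow> real) \<Rightarrow> nat \<Rightarrow> real" where
  "padded N u j = (if j = 0 then 0 else if enat j \<le> N then u j else 1)"

text \<open>
  At a jump the value of \<open>h\<close> need not lie between its one-sided limits, so the sign of \<open>h\<close> between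
  two crossings is only controlled off the countable set \<open>K\<close>.
\<close>
locale regular_sign_changes =
  fixes h :: "real \<Rightarrow> real" and E K :: "real set"
  assumes crossing: "\<And>u. u \<in> E \<Longrightarrow> u \<in> {0<..<1} \<and> (\<exists>e\<in>{1, -1}. \<exists>a b c. 0 \<le> a \<and> b \<le> u \<and> c \<le> 1 \<and>
      signed_on (-e) h a b \<and> (\<forall>v\<in>{b<..<u}. h v = 0) \<and> signed_on e h u c)"
    and regular: "\<And>e a b c d. e \<in> {1, -1} \<Longrightarrow> 0 \<le> a \<Longrightarrow> b \<le> c \<Longrightarrow> d \<le> 1 \<Longrightarrow>
      signed_on e h a b \<Longrightarrow> signed_on (-e) h c d \<Longrightarrow> E \<inter> {b..c} \<noteq> {} \<and> finite (E \<inter> {b..c})"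
    and countable_K: "countable K"
    and cont: "\<And>v. v \<in> {0<..<1} - K \<Longrightarrow> isCont h v"
begin

text \<open>If the two intervals are disjoint, regularity puts a crossing between them, and this
  point is strictly inside \<open>{l<..<r}\<close> because both intervals have positive length. If
  they overlap, \<open>h\<close> has both signs at a common point.\<close>

lemma no_crossing_same_sign:
  assumes no: "E \<inter> {l<..<r} = {}" and lr: "0 \<le> l" "r \<le> 1" and e: "e \<in> {1, -1}"
    and ab: "l \<le> a" "b \<le> r" "signed_on e h a b"
    and cd: "l \<le> c" "d \<le> r" "signed_on (-e) h c d"
  shows False
proof -
  have lt: "a < b" "c < d" using ab(3) cd(3) by (auto simp: signed_on_def)
  consider "b \<le> c" | "d \<le> a" | "max a c < min b d" using lt by linarith
  then show False
  proof cases
    case 1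
    then have "E \<inter> {b..c} \<noteq> {}" using regular[of e a b c d] assms by auto
    moreover have "{b..c} \<subseteq> {l<..<r}" using lt ab cd by auto
    ultimately show False using no by blast
  next
    case 2
    then have "E \<inter> {d..a} \<noteq> {}" using regular[of "-e" c d a b] assms by auto
    moreover have "{d..a} \<subseteq> {l<..<r}" using lt ab cd by auto
    ultimately show False using no by blast
  next
    case 3
    then obtain v where "max a c < v" "v < min b d" using dense by blast
    then have "v \<in> {a<..<b}" "v \<in> {c<..<d}" by auto
    then have "0 < e * h v" "0 < -e * h v" using ab(3) cd(3) unfolding signed_on_def by blast+
    then show False by simp
  qed
qed

lemma signed_neighbourhood:
  assumes v: "v \<in> {l<..<r} - K" and lr: "0 \<le> l" "r \<le> 1" and pos: "0 < e * h v"
  obtains a b where "l \<le> a" "a < v" "v < b" "b \<le> r" "signed_on e h a b"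
proof -
  have "isCont (\<lambda>v. e * h v) v"
    using v lr by (intro continuous_intros cont) auto
  then obtain \<delta> where \<delta>: "\<delta> > 0" "\<And>y. dist y v < \<delta> \<Longrightarrow> dist (e * h y) (e * h v) < e * h v"
    using pos unfolding continuous_at_eps_delta by blast
  have "0 < e * h y" if "dist y v < \<delta>" for y
    using \<delta>(2)[OF that] by (auto simp: dist_real_def)
  then have "signed_on e h (max l (v - \<delta>)) (min r (v + \<delta>))"
    using v \<delta>(1) by (auto simp: signed_on_def dist_real_def)
  then show ?thesis using v \<delta>(1) by (intro that[of "max l (v - \<delta>)" "min r (v + \<delta>)"]) auto
qed

text \<open>A strictly opposite sign at a continuity point spreads to an interval, which
  \<open>no_crossing_same_sign\<close> excludes. Points of \<open>K\<close> escape this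
  argument.\<close>

lemma no_crossing_weak_sign:
  assumes no: "E \<inter> {l<..<r} = {}" and lr: "0 \<le> l" "r \<le> 1" and e: "e \<in> {1, -1}"
    and ab: "l \<le> a" "b \<le> r" "signed_on e h a b" and v: "v \<in> {l<..<r} - K"
  shows "0 \<le> e * h v"
proof (rule ccontr)
  assume "\<not> 0 \<le> e * h v"
  then obtain c d where "l \<le> c" "d \<le> r" "signed_on (-e) h c d"
    using signed_neighbourhood[OF v lr, of "-e"] by (metis minus_mult_left neg_0_less_iff_less not_le)
  then show False using no_crossing_same_sign[OF no lr e ab] by blast
qed

section \<open>Enumerated crossings and alternation of signs\<close>

context
  fixes N :: enat and u :: "nat \<Rightarrow> real"
  assumes N: "1 \<le> N" and enum: "enumerates E N u"
begin

abbreviation w :: "nat \<Rightarrow> real" where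
  "w \<equiv> padded N u"

lemma w_0 [simp]: "w 0 = 0" by (simp add: padded_def)

lemma w_eq_u: "1 \<le> j \<Longrightarrow> enat j \<le> N \<Longrightarrow> w j = u j" by (simp add: padded_def)

lemma w_in_E: "1 \<le> j \<Longrightarrow> enat j \<le> N \<Longrightarrow> w j \<in> E"
  using enum by (auto simp: w_eq_u enumerates_def)

lemma E_obtain:
  assumes "v \<in> E" obtains j where "1 \<le> j" "enat j \<le> N" "v = w j"
proof -
  from assms enum obtain j where "1 \<le> j" "enat j \<le> N" "v = u j"
    unfolding enumerates_def by blast
  then show ?thesis using that w_eq_u by metis
qed

lemma w_range: "0 \<le> w j" "w j \<le> 1"
  using crossing[OF w_in_E[of j]] by (auto simp: padded_def less_imp_le)

lemma w_less_Suc: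
  assumes "enat j \<le> N" shows "w j < w (Suc j)"
proof (cases "enat (Suc j) \<le> N")
  case True
  show ?thesis
  proof (cases "j = 0")
    case True
    then show ?thesis using crossing[OF w_in_E[of "Suc j"]] \<open>enat (Suc j) \<le> N\<close> by auto
  next
    case False
    then show ?thesis using True assms enum
      by (auto simp: w_eq_u enumerates_def intro!: strict_mono_onD[where A = "{j. 1 \<le> j \<and> enat j \<le> N}"])
  qed
next
  case False
  then have "j \<noteq> 0" using N by (metis One_nat_def one_enat_def)
  moreover have "w (Suc j) = 1" using False by (simp add: padded_def)
  ultimately show ?thesis using crossing[OF w_in_E[of j]] assms by auto
qed

lemma incseq_w: "incseq w"
proof (rule incseq_SucI)
  fix j show "w j \<le> w (Suc j)"
  proof (cases "enat j \<le> N")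
    case False
    then have "\<not> enat (Suc j) \<le> N" by (meson Suc_ile_eq less_imp_le)
    then show ?thesis using w_range by (simp add: padded_def)
  qed (use w_less_Suc in \<open>auto intro: less_imp_le\<close>)
qed

lemma w_gap: "E \<inter> {w j<..<w (Suc j)} = {}"
proof -
  have "v \<notin> {w j<..<w (Suc j)}" if v: "v \<in> E" for v
  proof -
    obtain i where "v = w i" using E_obtain[OF v] by metis
    then show ?thesis
      using incseqD[OF incseq_w, of i j] incseqD[OF incseq_w, of "Suc j" i]
      by (cases "i \<le> j") auto
  qed
  then show ?thesis by blast
qed

text \<open>The interval stops at the next crossing, so that it lies in a gap of \<open>E\<close>
  and the lemmas on crossing-free intervals apply to it.\<close>

definition right_sign :: "real \<Rightarrow> nat \<Rightarrow> bool" where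
  "right_sign e j \<longleftrightarrow> (\<exists>c \<le> w (Suc j). signed_on e h (w j) c)"

lemma crossing_w:
  assumes "1 \<le> j" "enat j \<le> N"
  obtains e a b where "e \<in> {1, -1}" "0 \<le> a" "b \<le> w j" "signed_on (-e) h a b"
    "\<forall>v\<in>{b<..<w j}. h v = 0" "right_sign e j"
proof -
  obtain e a b c where *: "e \<in> {1, -1}" "0 \<le> a" "b \<le> w j" "signed_on (-e) h a b"
    "\<forall>v\<in>{b<..<w j}. h v = 0" "signed_on e h (w j) c"
    using crossing[OF w_in_E[OF assms]] by blast
  moreover have "right_sign e j" unfolding right_sign_def
    using signed_on_subinterval[OF *(6), of "w j" "min c (w (Suc j))"] *(6) w_less_Suc[OF assms(2)]
    by (intro exI[of _ "min c (w (Suc j))"]) (auto simp: signed_on_def)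
  ultimately show ?thesis using that by blast
qed

text \<open>The strict sign before the zero stretch that leads to the next crossing is taken inside
  the gap after \<open>w j\<close>. It must agree with the sign \<open>e\<close> just right of
  \<open>w j\<close>, and the next crossing reverses it.\<close>

lemma right_sign_Suc:
  assumes j: "1 \<le> j" "enat (Suc j) \<le> N" and e: "e \<in> {1, -1}" "right_sign e j"
  shows "right_sign (-e) (Suc j)"
proof -
  obtain e' a b where c: "e' \<in> {1, -1}" "0 \<le> a" "b \<le> w (Suc j)" "signed_on (-e') h a b"
    "\<forall>v\<in>{b<..<w (Suc j)}. h v = 0" "right_sign e' (Suc j)"
    using crossing_w[of "Suc j"] j by auto
  obtain d where d: "d \<le> w (Suc j)" "signed_on e h (w j) d"
    using e(2) by (auto simp: right_sign_def)
  \<comment> \<open>Otherwise the zero stretch before the next crossing would reach back to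
    \<open>w j\<close> and meet the interval on which \<open>h\<close> is nonzero.\<close>
  have "w j < b"
  proof (rule ccontr)
    assume "\<not> w j < b"
    moreover have "w j < d" using d(2) by (simp add: signed_on_def)
    then obtain v where v: "w j < v" "v < d" using dense by blast
    ultimately have "h v = 0" using c(5) d(1) by auto
    moreover have "0 < e * h v" using d(2) v by (auto simp: signed_on_def)
    ultimately show False by simp
  qed
  then have "signed_on (-e') h (max a (w j)) b"
    using c(4) by (intro signed_on_subinterval[OF c(4)]) (auto simp: signed_on_def)
  then have "e' \<noteq> e"
    using no_crossing_same_sign[OF w_gap w_range(1) w_range(2) e(1), of j "w j" d "max a (w j)" b] c d
    by auto
  then have "e' = -e" using c(1) e(1) by auto
  then show ?thesis using c(6) by simp
qed

lemma alternating_signs: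
  obtains e a b where "e \<in> {1, -1}" "0 \<le> a" "b \<le> w 1" "signed_on (-e) h a b"
    "\<forall>i. enat (Suc i) \<le> N \<longrightarrow> right_sign ((-1) ^ i * e) (Suc i)"
proof -
  obtain e a b where *: "e \<in> {1, -1}" "0 \<le> a" "b \<le> w 1" "signed_on (-e) h a b" "right_sign e 1"
    using crossing_w[of 1] N unfolding one_enat_def by (metis order_refl)
  have "right_sign ((-1) ^ i * e) (Suc i)" if "enat (Suc i) \<le> N" for i
    using that
  proof (induction i)
    case (Suc i)
    have "(-1) ^ i * e \<in> {1, -1}" using *(1) by (cases "even i") auto
    moreover have "right_sign ((-1) ^ i * e) (Suc i)"
      using Suc by (meson Suc_ile_eq less_imp_le)
    ultimately show ?case using right_sign_Suc[of "Suc i" "(-1) ^ i * e"] Suc.prems by simp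
  qed (use * in simp)
  then show ?thesis using that * by blast
qed

text \<open>With \<open>e\<close> the sign just after the first crossing, \<open>e * h\<close> is
  weakly negative before it and alternates from gap to gap, as the telescoping lemma requires. The
  interval of sign \<open>-e\<close> before the first crossing is also returned, since it later
  identifies \<open>e\<close> from the weak sign of \<open>g\<close> there.\<close>

lemma sign_changes_sums:
  assumes hi: "h absolutely_integrable_on {0..1}"
  obtains e a b where "e \<in> {1, -1}" "0 \<le> a" "b \<le> u 1" "signed_on (-e) h a b"
    "(\<lambda>j. (-1) ^ j * integral {padded N u (Suc j)..1} (\<lambda>v. e * h v)) sums integral {0..1} (\<lambda>v. max (e * h v) 0)"
proof -
  obtain e a b where e: "e \<in> {1, -1}" and ab: "0 \<le> a" "b \<le> w 1" "signed_on (-e) h a b"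
    and all_right: "\<forall>i. enat (Suc i) \<le> N \<longrightarrow> right_sign ((-1) ^ i * e) (Suc i)"
    using alternating_signs by blast
  from all_right have right: "right_sign ((-1) ^ i * e) (Suc i)" if "enat (Suc i) \<le> N" for i
    using that by simp
  have pe: "(-1) ^ i * e \<in> {1, -1}" for i using e by (cases "even i") auto
  obtain L where L: "w \<longlonglongrightarrow> L"
    using w_range(2) by (auto intro: incseq_convergent[OF incseq_w, of 1])
  have "(\<lambda>j. (-1) ^ j * integral {w (Suc j)..1} (\<lambda>v. e * h v)) sums integral {0..1} (\<lambda>v. max (e * h v) 0)"
  proof (rule alternating_tail_integrals_sums)
    have *: "(\<lambda>v. e * h v) absolutely_integrable_on {0..1}"
      using hi by (rule set_integrable_mult_right)
    then show "(\<lambda>v. e * h v) integrable_on {0..1}"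
      by (rule set_lebesgue_integral_eq_integral(1))
    show "(\<lambda>v. max (e * h v) 0) integrable_on {0..1}"
      using absolutely_integrable_max_1[OF *, of "\<lambda>_. 0"]
      by (simp add: set_lebesgue_integral_eq_integral(1))
    show "countable K" by (rule countable_K)
    show "(-1) ^ j * (e * h v) \<le> 0" if v: "v \<in> {w j<..<w (Suc j)} - K" for j v
    proof (cases j)
      case 0
      then show ?thesis
        using no_crossing_weak_sign[OF w_gap w_range(1) w_range(2), of "-e" j a b v] e ab v by auto
    next
      case (Suc i)
      have "enat j \<le> N"
      proof (rule ccontr)
        assume "\<not> enat j \<le> N"
        then have "w j = 1" using Suc by (simp add: padded_def)
        then show False using v w_range(2)[of "Suc j"] by auto
      qed
      then obtain d where d: "d \<le> w (Suc j)" "signed_on ((-1) ^ i * e) h (w j) d"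
        using right[of i] Suc by (auto simp: right_sign_def)
      then have "0 \<le> (-1) ^ i * e * h v"
        using no_crossing_weak_sign[OF w_gap w_range(1) w_range(2) pe, of j "w j" d i v] v by simp
      then show ?thesis using Suc by simp
    qed
    show "e * h v = 0" if v: "v \<in> {L<..<1} - K" for v
    proof (rule ccontr)
      \<comment> \<open>A nonzero value beyond \<open>L\<close> rules out the padding value 1, so
        there are infinitely many crossings. The parity of \<open>i\<close> is chosen to make the
        sign after \<open>w (Suc i)\<close> opposite to that of \<open>h v\<close>; regularity then
        allows only finitely many crossings in between.\<close>
      assume nz: "e * h v \<noteq> 0"
      have wL: "w j \<le> L" for j by (rule incseq_le[OF incseq_w L])
      have inf: "enat j \<le> N" for j
      proof (rule ccontr)
        assume "\<not> enat j \<le> N"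
        then have "w j = 1" using N by (cases "j = 0") (auto simp: padded_def zero_enat_def[symmetric])
        then show False using wL[of j] v by auto
      qed
      obtain i where i: "i \<in> {0, 1::nat}" "0 < - ((-1) ^ i * e) * h v"
        using nz by (cases "0 < e * h v") force+
      have L0: "0 \<le> L" using wL[of 0] by simp
      obtain c d where cd: "L \<le> c" "d \<le> 1" "signed_on (- ((-1) ^ i * e)) h c d"
        using signed_neighbourhood[OF v L0 order_refl i(2)] by metis
      obtain d' where d': "d' \<le> w (Suc (Suc i))" "signed_on ((-1) ^ i * e) h (w (Suc i)) d'"
        using right[OF inf, of i] unfolding right_sign_def by blast
      have "d' \<le> L" using d'(1) wL[of "Suc (Suc i)"] by simp
      then have "finite (E \<inter> {d'..c})"
        using regular[OF pe w_range(1) _ cd(2) d'(2) cd(3)] cd(1) by simp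
      \<comment> \<open>Index 3 suffices for either parity, since \<open>d'\<close> is at most
        \<open>w (Suc (Suc i))\<close> and \<open>i\<close> is at most 1.\<close>
      moreover have "w ` {3..} \<subseteq> E \<inter> {d'..c}"
      proof -
        have "w (Suc (Suc i)) \<le> w j" if "j \<ge> 3" for j
          using incseqD[OF incseq_w, of "Suc (Suc i)" j] that i(1) by auto
        then show ?thesis using w_in_E inf order_trans[OF wL cd(1)] order_trans[OF d'(1)] by auto
      qed
      ultimately have "finite (w ` {3..})" by (rule finite_subset[rotated])
      moreover have "strict_mono w" using w_less_Suc inf by (simp add: strict_mono_Suc_iff)
      then have "inj_on w {3..}" by (meson inj_on_subset strict_mono_imp_inj_on subset_UNIV)
      ultimately show False using finite_imageD[of w "{3..}"] infinite_Ici[of "3::nat"] by simp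
    qed
  qed (use incseq_w w_range L in auto)
  moreover have "b \<le> u 1" using ab(2) N by (simp add: padded_def one_enat_def)
  ultimately show ?thesis using e ab by (intro that[of e a b])
qed

end

end

section \<open>Countermonotonic sums\<close>

lemma has_integral_reflect_unit:
  fixes f :: "real \<Rightarrow> real"
  assumes "(f has_integral I) {a..b}"
  shows "((\<lambda>v. f (1 - v)) has_integral I) {1 - b..1 - a}"
proof -
  have f: "(\<lambda>v. f (-1 *\<^sub>R v + 1)) = (\<lambda>v. f (1 - v))"
    by (simp add: fun_eq_iff)
  have "(\<lambda>v. (1 / -1) *\<^sub>R v + - ((1 / -1) *\<^sub>R 1)) ` cbox a b = (\<lambda>v. 1 - v) ` {a..b}"
    by (intro image_cong) simp_all
  also have "\<dots> = {1 - b..1 - a}" by simp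
  finally show ?thesis
    using has_integral_affinity[of f I a b "-1" 1] assms unfolding f by simp
qed

lemma absolutely_integrable_reflect_unit:
  fixes f :: "real \<Rightarrow> real"
  assumes "f absolutely_integrable_on {0..1}"
  shows "(\<lambda>v. f (1 - v)) absolutely_integrable_on {0..1}"
proof -
  have "(\<lambda>v. k (1 - v)) integrable_on {0..1}" if "k integrable_on {0..1}" for k :: "real \<Rightarrow> real"
    using has_integral_reflect_unit[OF integrable_integral[OF that]] by (simp add: has_integral_integrable)
  from this[of f] this[of "\<lambda>v. norm (f v)"] show ?thesis
    using assms unfolding absolutely_integrable_on_def by simp
qed

text \<open>Agreement of \<open>f v - x\<close> and \<open>h\<close> is asked for only in the open
  interval: at 0 and 1 the function \<open>g\<close> may be infinite, and the endpoints do not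
  affect the integral.\<close>

lemma upper_tail_uniform:
  fixes f h :: "real \<Rightarrow> real"
  assumes U: "uniform_unit P U"
    and f [measurable]: "f \<in> borel_measurable borel"
    and h: "h absolutely_integrable_on {0..1}"
    and fh: "\<And>v. v \<in> {0<..<1} \<Longrightarrow> f v - x = h v"
  shows "upper_tail P (\<lambda>\<omega>. f (U \<omega>)) x = integral {0..1} (\<lambda>v. max (h v) 0)"
proof -
  have [measurable]: "U \<in> borel_measurable P" and D: "distr P borel U = uniform_measure lborel {0..1}"
    using U by (auto simp: uniform_unit_def)
  have unif: "uniform_measure lborel {0..1::real} = density lborel (\<lambda>v. ennreal (indicator {0..1} v))"
    unfolding uniform_measure_def by (intro density_cong) (auto simp: indicator_def)
  have ai: "(\<lambda>v. max (h v) 0) absolutely_integrable_on {0..1}"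
    using absolutely_integrable_max_1[OF h, of "\<lambda>_. 0"] by simp
  also have "?this \<longleftrightarrow> (\<lambda>v. max (f v - x) 0) absolutely_integrable_on {0..1}"
    unfolding absolutely_integrable_on_Icc_iff_Ioo
    by (intro set_integrable_cong) (auto simp: fh)
  finally have ai': "(\<lambda>v. max (f v - x) 0) absolutely_integrable_on {0..1}" .
  have "upper_tail P (\<lambda>\<omega>. f (U \<omega>)) x = (\<integral>v. max (f v - x) 0 \<partial>distr P borel U)"
    unfolding upper_tail_def by (subst integral_distr) auto
  also have "\<dots> = (\<integral>v. indicator {0..1} v *\<^sub>R max (f v - x) 0 \<partial>lborel)"
    unfolding D unif by (subst integral_density) auto
  also have "\<dots> = (LINT v:{0..1}|lebesgue. max (f v - x) 0)"
    unfolding set_lebesgue_integral_def by (subst integral_completion) auto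
  also have "\<dots> = integral {0..1} (\<lambda>v. max (f v - x) 0)"
    by (rule set_lebesgue_integral_eq_integral(2)[OF ai'])
  also have "\<dots> = integral {0..1} (\<lambda>v. max (h v) 0)"
    by (rule integral_spike[of "{0, 1}"]) (auto simp: fh)
  finally show ?thesis .
qed

lemma crossing_setE:
  assumes "u \<in> crossing_set g x"
  obtains a b c where "u \<in> {0<..<1}" "0 \<le> a" "0 \<le> b" "b \<le> 1" "c \<le> 1" "a < b" "b \<le> u" "u < c"
    "(\<forall>v\<in>{a<..<b}. g v < ereal x) \<and> (\<forall>v\<in>{b<..<u}. g v = ereal x) \<and> (\<forall>v\<in>{u<..<c}. g v > ereal x)
      \<or> (\<forall>v\<in>{a<..<b}. g v > ereal x) \<and> (\<forall>v\<in>{b<..<u}. g v = ereal x) \<and> (\<forall>v\<in>{u<..<c}. g v < ereal x)"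
  using assms unfolding crossing_set_def mem_Collect_eq
  by (elim conjE bexE) (rule that; (assumption | simp))

section \<open>The excess of the countermonotonic sum over the level\<close>

locale real_random_pair =
  A: real_random_variable M X1 + B: real_random_variable M X2
  for M :: "'a measure" and X1 X2 :: "'a \<Rightarrow> real" +
  fixes x :: real
begin

definition excess :: "real \<Rightarrow> real" where
  "excess v = A.Q v + B.Q (1 - v) - x"

definition jumps :: "real set" where
  "jumps = {v \<in> {0<..<1}. \<not> isCont A.Q v} \<union> (\<lambda>v. 1 - v) ` {v \<in> {0<..<1}. \<not> isCont B.Q v}"

lemma countermonotonic_g_eq:
  "v \<in> {0<..<1} \<Longrightarrow> countermonotonic_g M X1 X2 v = ereal (excess v + x)"
  by (simp add: countermonotonic_g_def A.quantile_eq B.quantile_eq excess_def)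

lemma countable_jumps: "countable jumps"
  unfolding jumps_def
  using mono_on_ctble_discont_open[OF _ A.Q_mono] mono_on_ctble_discont_open[OF _ B.Q_mono]
  by (simp add: countable_Un_iff)

lemma isCont_excess:
  assumes "v \<in> {0<..<1} - jumps"
  shows "isCont excess v"
proof -
  have "isCont A.Q v" using assms by (auto simp: jumps_def)
  moreover have "isCont B.Q (1 - v)"
  proof (rule ccontr)
    assume "\<not> isCont B.Q (1 - v)"
    then have "1 - (1 - v) \<in> jumps" using assms unfolding jumps_def by (intro UnI2 imageI) auto
    with assms show False by simp
  qed
  then have "isCont (\<lambda>v. B.Q (1 - v)) v" by (rule isCont_o2[rotated]) (intro continuous_intros)
  ultimately show ?thesis unfolding excess_def[abs_def] by (intro continuous_intros)
qed

text \<open>The reflection \<open>1 - v\<close> exchanges the two sides, so a left limit pairs the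
  lower quantile of \<open>X1\<close> with the upper quantile of \<open>X2\<close>. Where both
  summands jump, the value of \<open>excess\<close> may differ from both one-sided limits.\<close>

lemma tendsto_excess_left:
  assumes "v \<in> {0<..<1}"
  shows "(excess \<longlongrightarrow> A.Q v + B.Qu (1 - v) - x) (at_left v)"
proof -
  have "filterlim (\<lambda>v. 1 - v) (at_right (1 - v)) (at_left v)"
    by (auto simp: filterlim_at eventually_at_filter intro!: tendsto_eq_intros)
  then have "((\<lambda>v. B.Q (1 - v)) \<longlongrightarrow> B.Qu (1 - v)) (at_left v)"
    using assms by (intro filterlim_compose[OF B.tendsto_Q_right]) auto
  then show ?thesis
    unfolding excess_def[abs_def] using A.tendsto_Q_left[OF assms] by (intro tendsto_intros)
qed

lemma tendsto_excess_right:
  assumes "v \<in> {0<..<1}"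
  shows "(excess \<longlongrightarrow> A.Qu v + B.Q (1 - v) - x) (at_right v)"
proof -
  have "filterlim (\<lambda>v. 1 - v) (at_left (1 - v)) (at_right v)"
    by (auto simp: filterlim_at eventually_at_filter intro!: tendsto_eq_intros)
  then have "((\<lambda>v. B.Q (1 - v)) \<longlongrightarrow> B.Q (1 - v)) (at_right v)"
    using assms by (intro filterlim_compose[OF B.tendsto_Q_left]) auto
  then show ?thesis
    unfolding excess_def[abs_def] using A.tendsto_Q_right[OF assms] by (intro tendsto_intros)
qed

text \<open>The sum of the mixed quantiles minus \<open>x\<close> is
  \<open>(1 - \<alpha>) * l + \<alpha> * r\<close>, where \<open>l\<close> and \<open>r\<close> are
  the one-sided limits of \<open>excess\<close>. At a crossing these have weakly opposite signs, so
  this affine function of \<open>\<alpha>\<close> has a zero in the unit interval.\<close>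

lemma crossing_level:
  assumes v: "v \<in> {0<..<1}" and bv: "b \<le> v"
    and left: "signed_on (-e) excess a b" "\<forall>w\<in>{b<..<v}. excess w = 0"
    and right: "signed_on e excess v c"
  obtains \<alpha> where "\<alpha> \<in> {0..1}"
    "ereal x = mixed_quantile M X1 \<alpha> v + mixed_quantile M X2 (1 - \<alpha>) (1 - v)"
proof -
  define l where "l = A.Q v + B.Qu (1 - v) - x"
  define r where "r = A.Qu v + B.Q (1 - v) - x"
  have ev_left: "\<forall>\<^sub>F w in at_left v. e * excess w \<le> 0"
  proof (cases "b = v")
    case True
    then have "\<forall>\<^sub>F w in at_left v. w \<in> {a<..<b}"
      using left(1) eventually_at_left_real[of a v] by (simp add: signed_on_def)
    then show ?thesis by eventually_elim (use left(1) in \<open>auto simp: signed_on_def less_imp_le\<close>)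
  next
    case False
    then have "\<forall>\<^sub>F w in at_left v. w \<in> {b<..<v}"
      using bv by (intro eventually_at_left_real) auto
    then show ?thesis by eventually_elim (use left(2) in auto)
  qed
  have "((\<lambda>w. e * excess w) \<longlongrightarrow> e * l) (at_left v)"
    unfolding l_def by (intro tendsto_mult_left tendsto_excess_left v)
  then have l: "e * l \<le> 0"
    by (rule tendsto_upperbound[OF _ ev_left]) simp
  have "\<forall>\<^sub>F w in at_right v. w \<in> {v<..<c}"
    using right eventually_at_right_real[of v c] by (simp add: signed_on_def)
  then have ev_right: "\<forall>\<^sub>F w in at_right v. 0 \<le> e * excess w"
    by eventually_elim (use right in \<open>auto simp: signed_on_def less_imp_le\<close>)
  have "((\<lambda>w. e * excess w) \<longlongrightarrow> e * r) (at_right v)"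
    unfolding r_def by (intro tendsto_mult_left tendsto_excess_right v)
  then have r: "0 \<le> e * r"
    by (rule tendsto_lowerbound[OF _ ev_right]) simp
  have "e \<noteq> 0" using right dense[of v c] by (force simp: signed_on_def)
  obtain \<alpha> where \<alpha>: "\<alpha> \<in> {0..1}" "(1 - \<alpha>) * l + \<alpha> * r = 0"
  proof (cases "e * l = e * r")
    case True
    then have "l = 0" using l r \<open>e \<noteq> 0\<close> by simp
    then show ?thesis using that[of 0] by simp
  next
    case False
    \<comment> \<open>This is the zero \<open>l / (l - r)\<close> of the affine function; the factor
      \<open>e\<close> is kept because the sign information is about \<open>e * l\<close> and
      \<open>e * r\<close>.\<close>
    let ?a = "e * l / (e * l - e * r)"
    have "?a \<in> {0..1}" using l r False by (auto simp: divide_simps)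
    moreover have "?a = l / (l - r)"
      using \<open>e \<noteq> 0\<close> by (simp add: right_diff_distrib[symmetric])
    moreover have "(1 - l / (l - r)) * l + l / (l - r) * r = 0"
      using False by (simp add: field_simps)
    ultimately show ?thesis using that by metis
  qed
  have "(1 - \<alpha>) * A.Q v + \<alpha> * A.Qu v + (\<alpha> * B.Q (1 - v) + (1 - \<alpha>) * B.Qu (1 - v)) = x"
    using \<alpha>(2) unfolding l_def r_def by (simp add: algebra_simps)
  then have "ereal x = mixed_quantile M X1 \<alpha> v + mixed_quantile M X2 (1 - \<alpha>) (1 - v)"
    using v by (simp add: A.mixed_quantile_eq B.mixed_quantile_eq)
  with \<alpha>(1) show ?thesis by (rule that)
qed

text \<open>Outside the closed unit interval the two quantiles are infinite, so
  \<open>real_of_ereal\<close> sends their sum to 0, in agreement with the indicators. The points 0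
  and 1 are exempted as a finite set of exceptions.\<close>

lemma borel_measurable_real_g:
  "(\<lambda>v. real_of_ereal (countermonotonic_g M X1 X2 v)) \<in> borel_measurable borel"
proof (rule measurable_discrete_difference[where X = "{0, 1}"])
  have *: "(\<lambda>v. indicator {0<..<1} v * f v) \<in> borel_measurable borel"
    if "f \<in> borel_measurable (restrict_space lborel {0<..<1})" for f :: "real \<Rightarrow> real"
    using that by (simp add: borel_measurable_restrict_space_iff)
  show "(\<lambda>v. indicator {0<..<1} v * A.Q v
      + (\<lambda>v. indicator {0<..<1} v * B.Q v) (1 - v)) \<in> borel_measurable borel"
    by (rule borel_measurable_add[OF *[OF A.measurable_Q] measurable_compose[OF _ *[OF B.measurable_Q]]])
      simp
  show "indicator {0<..<1} v * A.Q v + (\<lambda>v. indicator {0<..<1} v * B.Q v) (1 - v)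
      = real_of_ereal (countermonotonic_g M X1 X2 v)" if v01: "v \<notin> {0, 1}" for v
  proof -
    consider "v < 0" | "v \<in> {0<..<1}" | "1 < v"
      using v01 linorder_less_linear[of v 0] linorder_less_linear[of v 1] by auto
    then show ?thesis
    proof cases
      case 2
      then show ?thesis by (simp add: countermonotonic_g_eq excess_def)
    qed (simp_all add: countermonotonic_g_def A.quantile_neg A.quantile_gt_1 B.quantile_neg B.quantile_gt_1)
  qed
qed auto

text \<open>The two alternatives in \<open>crossing_set\<close> and in
  \<open>regular_crossings\<close> become the two values of \<open>e\<close>.\<close>

lemma regular_sign_changes_excess:
  assumes "regular_crossings (countermonotonic_g M X1 X2) x"
  shows "regular_sign_changes excess (crossing_set (countermonotonic_g M X1 X2) x) jumps"
proof
  let ?g = "countermonotonic_g M X1 X2"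
  have pos: "signed_on 1 excess a b \<longleftrightarrow> a < b \<and> (\<forall>v\<in>{a<..<b}. ?g v > ereal x)"
    and neg: "signed_on (-1) excess a b \<longleftrightarrow> a < b \<and> (\<forall>v\<in>{a<..<b}. ?g v < ereal x)"
    and zero: "(\<forall>v\<in>{a<..<b}. excess v = 0) \<longleftrightarrow> (\<forall>v\<in>{a<..<b}. ?g v = ereal x)"
    if "0 \<le> a" "b \<le> 1" for a b
    using that by (auto simp: signed_on_def countermonotonic_g_eq)
  show "u \<in> {0<..<1} \<and> (\<exists>e\<in>{1, -1}. \<exists>a b c. 0 \<le> a \<and> b \<le> u \<and> c \<le> 1 \<and>
      signed_on (-e) excess a b \<and> (\<forall>v\<in>{b<..<u}. excess v = 0) \<and> signed_on e excess u c)"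
    if "u \<in> crossing_set ?g x" for u
  proof -
    from that obtain a b c where u: "u \<in> {0<..<1}"
      and abc: "0 \<le> a" "0 \<le> b" "b \<le> 1" "c \<le> 1" "a < b" "b \<le> u" "u < c"
      and "(\<forall>v\<in>{a<..<b}. ?g v < ereal x) \<and> (\<forall>v\<in>{b<..<u}. ?g v = ereal x) \<and> (\<forall>v\<in>{u<..<c}. ?g v > ereal x)
        \<or> (\<forall>v\<in>{a<..<b}. ?g v > ereal x) \<and> (\<forall>v\<in>{b<..<u}. ?g v = ereal x) \<and> (\<forall>v\<in>{u<..<c}. ?g v < ereal x)"
      by (rule crossing_setE)
    then consider
        "signed_on (-1) excess a b" "\<forall>v\<in>{b<..<u}. excess v = 0" "signed_on 1 excess u c"
      | "signed_on 1 excess a b" "\<forall>v\<in>{b<..<u}. excess v = 0" "signed_on (-1) excess u c"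
      using pos[of a b] neg[of a b] zero[of b u] pos[of u c] neg[of u c] u by (elim disjE) simp_all
    then show ?thesis
    proof cases
      case 1
      with u abc show ?thesis by (intro conjI bexI[of _ 1] exI[of _ a] exI[of _ b] exI[of _ c]) simp_all
    next
      case 2
      with u abc show ?thesis by (intro conjI bexI[of _ "-1"] exI[of _ a] exI[of _ b] exI[of _ c]) simp_all
    qed
  qed
  show "crossing_set ?g x \<inter> {b..c} \<noteq> {} \<and> finite (crossing_set ?g x \<inter> {b..c})"
    if e: "e \<in> {1, -1}" and abcd: "0 \<le> a" "b \<le> c" "d \<le> 1"
      and s: "signed_on e excess a b" "signed_on (-e) excess c d" for e a b c d
  proof -
    have "a < b" "c < d" using s by (auto simp: signed_on_def)
    then have "(\<forall>v\<in>{a<..<b}. ?g v < ereal x) \<and> (\<forall>v\<in>{c<..<d}. ?g v > ereal x) \<or>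
         (\<forall>v\<in>{a<..<b}. ?g v > ereal x) \<and> (\<forall>v\<in>{c<..<d}. ?g v < ereal x)"
      using e s abcd pos[of a b] neg[of a b] pos[of c d] neg[of c d] by (elim insertE) simp_all
    then show ?thesis
      using assms[unfolded regular_crossings_def, THEN spec[of _ a], THEN spec[of _ b],
          THEN spec[of _ c], THEN spec[of _ d]] \<open>a < b\<close> \<open>c < d\<close> abcd by simp
  qed
qed (use countable_jumps isCont_excess in auto)

section \<open>Differences of tail transforms as integrals of the excess\<close>

context
  assumes fin1: "finite_risk_measures M X1" and fin2: "finite_risk_measures M X2"
begin

lemma integrable_excess: "excess absolutely_integrable_on {0..1}"
proof -
  have "(\<lambda>v. A.Q v + B.Q (1 - v)) absolutely_integrable_on {0..1}"
    by (rule set_integral_add(1)[OF A.integrable_Q[OF fin1]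
          absolutely_integrable_reflect_unit[OF B.integrable_Q[OF fin2]]])
  moreover have "(\<lambda>_::real. x) absolutely_integrable_on {0..1}"
    by (intro absolutely_integrable_continuous_real continuous_on_const)
  ultimately show ?thesis
    unfolding excess_def[abs_def] by (rule set_integral_diff(1))
qed

context
  fixes v \<alpha> :: real
  assumes v: "v \<in> {0<..<1}" and \<alpha>: "\<alpha> \<in> {0..1}"
    and level: "ereal x = mixed_quantile M X1 \<alpha> v + mixed_quantile M X2 (1 - \<alpha>) (1 - v)"
begin

private definition "d1 = (1 - \<alpha>) * A.Q v + \<alpha> * A.Qu v"
private definition "d2 = \<alpha> * B.Q (1 - v) + (1 - \<alpha>) * B.Qu (1 - v)"

private lemma v': "1 - v \<in> {0<..<1}" using v by auto

private lemma mixed: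
  "mixed_quantile M X1 \<alpha> v = ereal d1" "mixed_quantile M X2 (1 - \<alpha>) (1 - v) = ereal d2"
  using A.mixed_quantile_eq[OF v] B.mixed_quantile_eq[OF v'] by (simp_all add: d1_def d2_def)

private lemma sum_eq: "d1 + d2 = x"
  using level mixed by simp

text \<open>Both values are convex combinations of lower and upper quantile, which makes the tail
  integrals available; the lower bounds are obtained as upper bounds for the negated
  numbers.\<close>

private lemma between: "d1 \<in> {A.Q v..A.Qu v}" "d2 \<in> {B.Q (1 - v)..B.Qu (1 - v)}"
  using A.Q_le_Qu[OF v] B.Q_le_Qu[OF v'] \<alpha>
    convex_bound_le[of "A.Q v" "A.Qu v" "A.Qu v" "1 - \<alpha>" \<alpha>]
    convex_bound_le[of "- A.Q v" "- A.Q v" "- A.Qu v" "1 - \<alpha>" \<alpha>]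
    convex_bound_le[of "B.Q (1 - v)" "B.Qu (1 - v)" "B.Qu (1 - v)" \<alpha> "1 - \<alpha>"]
    convex_bound_le[of "- B.Q (1 - v)" "- B.Q (1 - v)" "- B.Qu (1 - v)" \<alpha> "1 - \<alpha>"]
  by (auto simp: d1_def d2_def)

text \<open>Reflection moves the lower tail integral of \<open>X2\<close> from
  \<open>{0..1 - v}\<close> to \<open>{v..1}\<close>. The constants \<open>d1\<close> and
  \<open>d2\<close> then combine to \<open>x\<close>, whatever admissible \<open>\<alpha>\<close>
  was chosen.\<close>

lemma tail_difference_right:
  "upper_tail_at M X1 \<alpha> v - lower_tail_at M X2 (1 - \<alpha>) (1 - v) = integral {v..1} excess"
proof -
  have "((\<lambda>w. d2 - B.Q (1 - w)) has_integral lower_tail M X2 d2) {v..1}"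
    using has_integral_reflect_unit[OF B.lower_tail_has_integral[OF fin2 v' between(2)]] v by simp
  from has_integral_diff[OF A.upper_tail_has_integral[OF fin1 v between(1)] this]
  have "((\<lambda>w. (A.Q w - d1) - (d2 - B.Q (1 - w))) has_integral upper_tail M X1 d1 - lower_tail M X2 d2) {v..1}" .
  also have "(\<lambda>w. (A.Q w - d1) - (d2 - B.Q (1 - w))) = excess"
    unfolding excess_def[abs_def] using sum_eq by auto
  finally show ?thesis
    by (simp add: upper_tail_at_def lower_tail_at_def mixed integral_unique)
qed

lemma tail_difference_left:
  "upper_tail_at M X2 (1 - \<alpha>) (1 - v) - lower_tail_at M X1 \<alpha> v = integral {0..v} excess"
proof -
  have "((\<lambda>w. B.Q (1 - w) - d2) has_integral upper_tail M X2 d2) {0..v}"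
    using has_integral_reflect_unit[OF B.upper_tail_has_integral[OF fin2 v' between(2)]] v by simp
  from has_integral_diff[OF this A.lower_tail_has_integral[OF fin1 v between(1)]]
  have "((\<lambda>w. (B.Q (1 - w) - d2) - (d1 - A.Q w)) has_integral upper_tail M X2 d2 - lower_tail M X1 d1) {0..v}" .
  also have "(\<lambda>w. (B.Q (1 - w) - d2) - (d1 - A.Q w)) = excess"
    unfolding excess_def[abs_def] using sum_eq by auto
  finally show ?thesis
    by (simp add: upper_tail_at_def lower_tail_at_def mixed integral_unique)
qed

end

end

end

section \<open>The stop-loss premium of the countermonotonic sum\<close>

theorem theorem6p2:
  fixes M :: "'a measure" and P :: "'b measure"
    and X1 X2 :: "'a \<Rightarrow> real" and U :: "'b \<Rightarrow> real"
    and g :: "real \<Rightarrow> ereal" and Sl :: "'b \<Rightarrow> real"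
    and x :: real and N :: enat and u :: "nat \<Rightarrow> real"
  assumes "prob_space M" and "prob_space P"
    and "X1 \<in> borel_measurable M" and "X2 \<in> borel_measurable M"
    and "finite_risk_measures M X1" and "finite_risk_measures M X2"
    and "uniform_unit P U"
    and g_def: "g = countermonotonic_g M X1 X2"
    and Sl_def: "Sl = (\<lambda>\<omega>. real_of_ereal (g (U \<omega>)))"
    and "\<not> degenerate P Sl"
    and "ereal x \<in> {x_min g<..<x_max g}"
    and "1 \<le> N" and "enumerates (crossing_set g x) N u"
    and "regular_crossings g x"
  shows "(\<forall>j. 1 \<le> j \<and> enat j \<le> N \<longrightarrow>
            (\<exists>a\<in>{0..1}. ereal x =
               mixed_quantile M X1 a (u j) + mixed_quantile M X2 (1 - a) (1 - u j)))
       \<and> (\<forall>\<alpha> :: nat \<Rightarrow> real.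
            (\<forall>j. 1 \<le> j \<and> enat j \<le> N \<longrightarrow> \<alpha> j \<in> {0..1} \<and> ereal x =
               mixed_quantile M X1 (\<alpha> j) (u j) + mixed_quantile M X2 (1 - \<alpha> j) (1 - u j))
            \<longrightarrow> summable (S_term M X1 X2 N u \<alpha>)
              \<and> ((\<forall>v\<in>{0<..<u 1}. g v \<le> ereal x) \<longrightarrow> upper_tail P Sl x = s1 M X1 X2 N u \<alpha>)
              \<and> ((\<forall>v\<in>{0<..<u 1}. g v \<ge> ereal x) \<longrightarrow> upper_tail P Sl x = s2 M X1 X2 N u \<alpha>))"
proof -
  interpret prob_space M by fact
  interpret real_random_pair M X1 X2 x
    by unfold_locales fact+
  let ?E = "crossing_set g x"
  note fin = \<open>finite_risk_measures M X1\<close> \<open>finite_risk_measures M X2\<close>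
  interpret R: regular_sign_changes excess ?E jumps
    using regular_sign_changes_excess assms(14) unfolding g_def by blast
  note enum = \<open>1 \<le> N\<close> \<open>enumerates ?E N u\<close>
  define I where "I j = integral {padded N u j..1} excess" for j
  define D where "D j \<longleftrightarrow> 1 \<le> j \<and> enat j \<le> N" for j
  have D1: "D 1" using enum(1) by (simp add: D_def one_enat_def)
  have padded_u: "padded N u j = u j" if "D j" for j
    using that by (simp add: padded_def D_def)
  have u_in_E: "u j \<in> ?E" if "D j" for j
    using R.w_in_E[OF enum, of j] that padded_u[OF that] by (simp add: D_def)
  have u01: "u j \<in> {0<..<1}" if "D j" for j
    using R.crossing[OF u_in_E[OF that]] by blast
  have I_eq: "I j = integral {u j..1} excess" if "D j" for j
    using padded_u[OF that] by (simp add: I_def)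
  have ex_level: "\<exists>a\<in>{0..1}. ereal x = mixed_quantile M X1 a (u j) + mixed_quantile M X2 (1 - a) (1 - u j)"
    if j: "D j" for j
  proof -
    obtain e a b c where "b \<le> u j" "signed_on (-e) excess a b" "\<forall>v\<in>{b<..<u j}. excess v = 0"
      "signed_on e excess (u j) c"
      using R.crossing[OF u_in_E[OF j]] by blast
    from crossing_level[OF u01[OF j] this] show ?thesis by blast
  qed
  obtain e a b where e: "e \<in> {1, -1}" and ab: "0 \<le> a" "b \<le> u 1" "signed_on (-e) excess a b"
    and sums: "(\<lambda>j. (-1) ^ j * integral {padded N u (Suc j)..1} (\<lambda>v. e * excess v))
      sums integral {0..1} (\<lambda>v. max (e * excess v) 0)"
    using R.sign_changes_sums[OF enum integrable_excess[OF fin]] .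
  have ee: "e * e = 1" using e by auto
  have tail: "upper_tail P Sl x = integral {0..1} (\<lambda>v. max (excess v) 0)"
    unfolding Sl_def g_def
    by (rule upper_tail_uniform[OF \<open>uniform_unit P U\<close> borel_measurable_real_g integrable_excess[OF fin]])
      (simp add: countermonotonic_g_eq)
  have excess_int: "excess integrable_on {0..1}"
    by (rule set_lebesgue_integral_eq_integral(1)[OF integrable_excess[OF fin]])
  let ?m = "integral {0..1} (\<lambda>v. max (e * excess v) 0)"
  have main: "summable (S_term M X1 X2 N u \<alpha>)
      \<and> ((\<forall>v\<in>{0<..<u 1}. g v \<le> ereal x) \<longrightarrow> upper_tail P Sl x = s1 M X1 X2 N u \<alpha>)
      \<and> ((\<forall>v\<in>{0<..<u 1}. g v \<ge> ereal x) \<longrightarrow> upper_tail P Sl x = s2 M X1 X2 N u \<alpha>)"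
    if level: "\<And>j. D j \<Longrightarrow> \<alpha> j \<in> {0..1} \<and> ereal x =
      mixed_quantile M X1 (\<alpha> j) (u j) + mixed_quantile M X2 (1 - \<alpha> j) (1 - u j)" for \<alpha>
  proof -
    have right: "upper_tail_at M X1 (\<alpha> j) (u j) - lower_tail_at M X2 (1 - \<alpha> j) (1 - u j) = I j"
      if "D j" for j
      using tail_difference_right[OF fin u01[OF that]] level[OF that] I_eq[OF that] by simp
    have S: "S_term M X1 X2 N u \<alpha> j = (if 2 \<le> j then (-1) ^ j * I j else 0)" for j
    proof (cases "2 \<le> j \<and> enat j \<le> N")
      case True
      then show ?thesis using right[of j] by (simp add: S_term_def D_def)
    next
      case False
      \<comment> \<open>Beyond the last crossing the padding is 1 and the tail integral is over a
        single point, which matches the truncation in \<open>S_term\<close>.\<close>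
      then have "I j = 0" if "2 \<le> j" using that by (simp add: I_def padded_def)
      with False show ?thesis by (auto simp: S_term_def)
    qed
    have "(\<lambda>j. (-1) ^ j * (e * I (Suc j))) sums ?m"
      using sums by (simp add: I_def)
    \<comment> \<open>The first term is split off because \<open>S_term\<close> starts at 2.
      Multiplying by \<open>- e\<close> and using \<open>e * e = 1\<close> removes \<open>e\<close>
      from the terms and restores the sign \<open>(-1) ^ (j + 2)\<close>.\<close>
    then have "(\<lambda>j. (-1) ^ Suc j * (e * I (Suc (Suc j)))) sums (?m - e * I 1)"
      by (subst sums_Suc_iff) simp
    then have "(\<lambda>j. - e * ((-1) ^ Suc j * (e * I (Suc (Suc j))))) sums (- e * (?m - e * I 1))"
      by (rule sums_mult)
    moreover have "- e * ((-1) ^ Suc j * (e * I (Suc (Suc j)))) = S_term M X1 X2 N u \<alpha> (j + 2)" for j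
      using ee by (simp add: S mult.assoc[symmetric])
    moreover have "- e * (?m - e * I 1) = I 1 - e * ?m"
      using ee by (simp add: algebra_simps mult.assoc[symmetric])
    ultimately have "(\<lambda>j. S_term M X1 X2 N u \<alpha> (j + 2)) sums (I 1 - e * ?m)"
      by simp
    then have S_sums: "S_term M X1 X2 N u \<alpha> sums (I 1 - e * ?m)"
      by (subst (asm) sums_iff_shift) (simp add: S numeral_2_eq_2)
    have s1: "s1 M X1 X2 N u \<alpha> = e * ?m"
      using sums_unique[OF S_sums] right[OF D1] by (simp add: s1_def)
    have "integral {0..1} excess = integral {0..u 1} excess + I 1"
      using excess_int u01[OF D1] I_eq[OF D1]
      by (simp add: Henstock_Kurzweil_Integration.integral_combine)
    moreover have "upper_tail_at M X2 (1 - \<alpha> 1) (1 - u 1) - lower_tail_at M X1 (\<alpha> 1) (u 1)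
        = integral {0..u 1} excess"
      using tail_difference_left[OF fin u01[OF D1]] level[OF D1] by simp
    ultimately have s2: "s2 M X1 X2 N u \<alpha> = integral {0..1} excess - e * ?m"
      using sums_unique[OF S_sums] by (simp add: s2_def)
    \<comment> \<open>A point before the first crossing where the sign is strict: there the weak
      sign of \<open>g\<close> assumed in each case determines \<open>e\<close>.\<close>
    obtain v where v: "a < v" "v < b" using ab(3) dense[of a b] unfolding signed_on_def by blast
    then have v1: "v \<in> {0<..<u 1}" using ab by auto
    have gv: "g v = ereal (excess v + x)"
      using v1 u01[OF D1] unfolding g_def by (intro countermonotonic_g_eq) auto
    have neg: "0 < - e * excess v" using ab(3) v by (auto simp: signed_on_def)
    have "upper_tail P Sl x = s1 M X1 X2 N u \<alpha>" if "\<forall>v\<in>{0<..<u 1}. g v \<le> ereal x"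
    proof -
      have "e = 1" using bspec[OF that v1] gv neg e by auto
      then show ?thesis using s1 tail by simp
    qed
    moreover have "upper_tail P Sl x = s2 M X1 X2 N u \<alpha>" if "\<forall>v\<in>{0<..<u 1}. g v \<ge> ereal x"
    proof -
      have e1: "e = -1" using bspec[OF that v1] gv neg e by auto
      have "(\<lambda>v. max (e * excess v) 0) integrable_on {0..1}"
        using absolutely_integrable_max_1[OF set_integrable_mult_right[OF integrable_excess[OF fin]],
            of "\<lambda>_. 0" e]
        by (simp add: set_lebesgue_integral_eq_integral(1))
      with excess_int have "integral {0..1} (\<lambda>v. excess v + max (e * excess v) 0) = integral {0..1} excess + ?m"
        by (rule Henstock_Kurzweil_Integration.integral_add)
      \<comment> \<open>For \<open>e = -1\<close> the series yields the negative part of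
        \<open>excess\<close>; adding \<open>excess\<close> turns it into the positive part, which
        is why \<open>s2\<close> uses the integral over the left side.\<close>
      moreover have "(\<lambda>v. excess v + max (e * excess v) 0) = (\<lambda>v. max (excess v) 0)"
        using e1 by (auto simp: max_def)
      ultimately show ?thesis using s2 tail e1 by simp
    qed
    ultimately show ?thesis using sums_summable[OF S_sums] by blast
  qed
  show ?thesis using ex_level main unfolding D_def by blast
qed

end
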